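(* Let $\mathcal{G}_{12,\mathrm{forest}}$ be the set of all permutations $\pi$ such that the occurrence graph $G_{12}(\pi)$ is a forest. Then \[ \mathcal{G}_{12,\mathrm{forest}} = \mathrm{Av}(123, 1432, 2143, 3214). \]
   Context: Permutations of all lengths $n\ge0$ are considered. For a permutation $\pi$ of length $n$, $V_{12}(\pi)$ is the set of pairs $\{i,j\}$ with $1\le i<j\le n$ and $\pi(i)<\pi(j)$, and the occurrence graph $G_{12}(\pi)$ is the simple undirected graph with vertex set $V_{12}(\pi)$ in which two vertices are adjacent iff they share exactly one element. A forest is a graph with no cycles (a disjoint union of trees); the graph with no vertices is a forest. A permutation $\pi$ contains a permutation $q$ of length $k$ if there are indices $i_1<\dots<i_k$ with $\pi(i_1)\cdots\pi(i_k)$ order-isomorphic to $q$, and avoids $q$ otherwise; $\mathrm{Av}(M)$ is the set of permutations avoiding every element of $M$. *)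

theory Defs
  imports "HOL-Combinatorics.Multiset_Permutations"
begin

(* A permutation of length n is represented by its one-line notation,
   i.e. a list that is a rearrangement of 1, ..., n. *)
definition perms :: "nat list set" where
  "perms = (\<Union>n. permutations_of_set {1..n})"

(* pval \<pi> i is \<pi>(i); positions are 1-based, so it is meaningful for 1 \<le> i \<le> length \<pi>. *)
definition pval :: "nat list \<Rightarrow> nat \<Rightarrow> nat" where
  "pval \<pi> i = \<pi> ! (i - 1)"

definition contains_pattern :: "nat list \<Rightarrow> nat list \<Rightarrow> bool" where
  "contains_pattern \<pi> q \<longleftrightarrow>
     (\<exists>i :: nat \<Rightarrow> nat.
        i ` {1..length q} \<subseteq> {1..length \<pi>} \<and>
        strict_mono_on {1..length q} i \<and>
        (\<forall>a\<in>{1..length q}. \<forall>b\<in>{1..length q}.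
           pval \<pi> (i a) < pval \<pi> (i b) \<longleftrightarrow> pval q a < pval q b))"

definition Av :: "nat list set \<Rightarrow> nat list set" where
  "Av M = {\<pi> \<in> perms. \<forall>q\<in>M. \<not> contains_pattern \<pi> q}"

(* Simple undirected graph: vertex set and set of two-element edges. *)
type_synonym 'v ugraph = "'v set \<times> 'v set set"

(* The requirement of at least three vertices excludes walking back and forth along one edge.
   The forest predicate of the digraph library does not exclude this for
   symmetric digraphs, so it is not usable here. *)
definition is_cycle :: "'v ugraph \<Rightarrow> 'v list \<Rightarrow> bool" where
  "is_cycle G c \<longleftrightarrow>
     3 \<le> length c \<and> distinct c \<and> set c \<subseteq> fst G \<and>
     (\<forall>k<length c. {c ! k, c ! (Suc k mod length c)} \<in> snd G)"

definition is_forest :: "'v ugraph \<Rightarrow> bool" where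
  "is_forest G \<longleftrightarrow> (\<nexists>c. is_cycle G c)"

definition V12 :: "nat list \<Rightarrow> nat set set" where
  "V12 \<pi> = {{i, j} | i j. 1 \<le> i \<and> i < j \<and> j \<le> length \<pi> \<and> pval \<pi> i < pval \<pi> j}"

(* There are no loops: a vertex u has two elements, so card (u \<inter> u) = 2. *)
definition G12 :: "nat list \<Rightarrow> nat set ugraph" where
  "G12 \<pi> = (V12 \<pi>, {{u, v} | u v. u \<in> V12 \<pi> \<and> v \<in> V12 \<pi> \<and> card (u \<inter> v) = 1})"

definition G12_forest :: "nat list set" where
  "G12_forest = {\<pi> \<in> perms. is_forest (G12 \<pi>)}"

end

theory Submission
  imports Defs
begin

text \<open>
  The occurrence graph \<open>G12 \<pi>\<close> is the line graph of the graph \<open>H\<close> on the positions of \<open>\<pi>\<close> whose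
  edges are the ascending pairs. A cycle of \<open>H\<close> gives a cycle of the line graph, and so does a
  vertex of degree at least three. Occurrences of 123 and 2143 yield cycles of \<open>H\<close> of lengths 3 and 4;
  those of 1432 and 3214 yield vertices of degree at least three.

  Conversely, let \<open>\<pi>\<close> avoid the four patterns. Avoiding 123 makes \<open>H\<close> triangle-free, so \<open>\<pi>\<close> decreases
  along the neighbours of each position; three neighbours of one position would then form 1432 or
  3214 with it. So \<open>H\<close> has maximal degree at most 2, and on a cycle of the line graph each endpoint
  of an edge lies on a second edge of the cycle. Let \<open>a\<close> be the leftmost position on the cycle, take
  its two edges \<open>{a, b}\<close>, \<open>{a, d}\<close> with \<open>b < d\<close>, and a further edge \<open>{a', b}\<close> of the cycle: then
  \<open>a < a' < b < d\<close> is an occurrence of 2143.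
\<close>

section \<open>Cycles in line graphs\<close>

definition line_graph :: "'v ugraph \<Rightarrow> 'v set ugraph" where
  "line_graph G = (snd G, {{u, v} | u v. u \<in> snd G \<and> v \<in> snd G \<and> card (u \<inter> v) = 1})"

text \<open>
  The claw need not be an induced subgraph: if all edges have two elements, its existence means
  that some vertex has degree at least three.
\<close>

definition has_claw :: "'v ugraph \<Rightarrow> bool" where
  "has_claw G \<longleftrightarrow> (\<exists>x y1 y2 y3. distinct [y1, y2, y3] \<and> {{x, y1}, {x, y2}, {x, y3}} \<subseteq> snd G)"

lemma vertices_line_graph [simp]: "fst (line_graph G) = snd G"
  by (simp add: line_graph_def)

lemma edge_line_graph_iff [simp]:
  "{u, v} \<in> snd (line_graph G) \<longleftrightarrow> u \<in> snd G \<and> v \<in> snd G \<and> card (u \<inter> v) = 1"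
  by (auto simp: line_graph_def doubleton_eq_iff Int_commute)

lemma is_cycle_two_neighboursE:
  assumes "is_cycle G c" "u \<in> set c"
  obtains v w where "v \<in> set c" "w \<in> set c" "v \<noteq> w" "{u, v} \<in> snd G" "{u, w} \<in> snd G"
proof -
  let ?n = "length c"
  have length_ge: "3 \<le> ?n" and "distinct c"
    and edge: "\<And>k. k < ?n \<Longrightarrow> {c ! k, c ! (Suc k mod ?n)} \<in> snd G"
    using assms(1) by (auto simp: is_cycle_def)
  obtain k where k: "k < ?n" "u = c ! k"
    using assms(2) by (auto simp: in_set_conv_nth)
  define succ where "succ = (if Suc k = ?n then 0 else Suc k)"
  define pred where "pred = (if k = 0 then ?n - 1 else k - 1)"
  have "Suc k mod ?n = succ" "Suc pred mod ?n = k"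
    using k length_ge by (auto simp: succ_def pred_def)
  moreover have bounds: "succ < ?n" "pred < ?n"
    using k length_ge by (auto simp: succ_def pred_def)
  ultimately have "{u, c ! succ} \<in> snd G" "{u, c ! pred} \<in> snd G"
    using edge[of k] edge[of pred] k by (simp_all add: insert_commute)
  moreover have "succ \<noteq> pred"
    using k length_ge by (auto simp: succ_def pred_def)
  then have "c ! succ \<noteq> c ! pred"
    using bounds \<open>distinct c\<close> by (simp add: nth_eq_iff_index_eq)
  ultimately show thesis
    using that[of "c ! succ" "c ! pred"] bounds by simp
qed

lemma is_cycle_line_graph:
  assumes "is_cycle G c"
  shows "is_cycle (line_graph G) (map (\<lambda>k. {c ! k, c ! (Suc k mod length c)}) [0..<length c])"
    (is "is_cycle _ (map ?edge [0..<?n])")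
proof -
  have length_ge: "3 \<le> ?n" "c \<noteq> []" and "distinct c"
    and edge: "\<And>k. k < ?n \<Longrightarrow> ?edge k \<in> snd G"
    using assms by (auto simp: is_cycle_def)
  have nth_inject: "c ! i = c ! j \<longleftrightarrow> i = j" if "i < ?n" "j < ?n" for i j
    using that \<open>distinct c\<close> by (simp add: nth_eq_iff_index_eq)
  have Suc_mod: "Suc k mod ?n = (if Suc k = ?n then 0 else Suc k)" if "k < ?n" for k
    using that by auto
  have "inj_on ?edge {0..<?n}"
    using length_ge
    by (auto intro!: inj_onI simp: doubleton_eq_iff nth_inject Suc_mod split: if_splits)
  moreover have "card (?edge k \<inter> ?edge (Suc k mod ?n)) = 1" if "k < ?n" for k
  proof -
    have inter: "?edge k \<inter> ?edge (Suc k mod ?n) = {c ! (Suc k mod ?n)}"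
      using that length_ge by (auto simp: nth_inject Suc_mod split: if_splits)
    show ?thesis
      unfolding inter by simp
  qed
  ultimately show ?thesis
    using length_ge edge by (auto simp: is_cycle_def distinct_map)
qed

lemma is_forest_if_is_forest_line_graph:
  "is_forest (line_graph G) \<Longrightarrow> is_forest G"
  unfolding is_forest_def using is_cycle_line_graph by blast

lemma not_has_claw_if_is_forest_line_graph:
  assumes "is_forest (line_graph G)"
  shows "\<not> has_claw G"
proof
  assume "has_claw G"
  then obtain x y1 y2 y3 where "distinct [y1, y2, y3]" "{{x, y1}, {x, y2}, {x, y3}} \<subseteq> snd G"
    by (auto simp: has_claw_def)
  then have "is_cycle (line_graph G) [{x, y1}, {x, y2}, {x, y3}]"
    by (auto simp: is_cycle_def less_Suc_eq doubleton_eq_iff Int_insert_left)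
  with assms show False
    by (auto simp: is_forest_def)
qed

lemma line_graph_cycle_second_edge:
  assumes card_edge: "\<forall>u\<in>snd G. card u = 2" and "\<not> has_claw G"
    and cycle: "is_cycle (line_graph G) c" and xy: "{x, y} \<in> set c"
  shows "\<exists>z. z \<noteq> y \<and> {x, z} \<in> set c"
proof -
  have edges: "set c \<subseteq> snd G"
    using cycle by (auto simp: is_cycle_def)
  have other_end: "\<exists>z. u = {t, z}" if "u \<in> set c" "t \<in> u" for u t
  proof -
    have "card u = 2"
      using card_edge edges that(1) by auto
    then show ?thesis
      using that(2) by (auto simp: card_2_iff)
  qed
  obtain v w where vw: "v \<in> set c" "w \<in> set c" "v \<noteq> w"
    and meet: "card ({x, y} \<inter> v) = 1" "card ({x, y} \<inter> w) = 1"
    using is_cycle_two_neighboursE[OF cycle xy] edge_line_graph_iff by metis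
  have "v \<noteq> {x, y}" "w \<noteq> {x, y}"
    using meet card_edge edges xy by auto
  have "{x, y} \<inter> v \<noteq> {}" "{x, y} \<inter> w \<noteq> {}"
    using meet by (metis card.empty zero_neq_one)+
  have "x \<in> v \<or> x \<in> w"
  proof (rule ccontr)
    assume "\<not> (x \<in> v \<or> x \<in> w)"
    with \<open>{x, y} \<inter> v \<noteq> {}\<close> \<open>{x, y} \<inter> w \<noteq> {}\<close> have "y \<in> v" "y \<in> w"
      by auto
    then obtain v' w' where "v = {y, v'}" "w = {y, w'}"
      using other_end vw by metis
    then have "distinct [x, v', w']" "{{y, x}, {y, v'}, {y, w'}} \<subseteq> snd G"
      using \<open>v \<noteq> {x, y}\<close> \<open>w \<noteq> {x, y}\<close> vw xy edges by (auto simp: insert_commute)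
    with \<open>\<not> has_claw G\<close> show False
      unfolding has_claw_def by blast
  qed
  then have "\<exists>z. {x, z} \<in> set c \<and> {x, z} \<noteq> {x, y}"
    using other_end vw \<open>v \<noteq> {x, y}\<close> \<open>w \<noteq> {x, y}\<close> by metis
  then show ?thesis
    by auto
qed

lemma line_graph_cycle_leftmost_pathE:
  fixes G :: "'v::wellorder ugraph"
  assumes card_edge: "\<forall>u\<in>snd G. card u = 2" and no_claw: "\<not> has_claw G"
    and cycle: "is_cycle (line_graph G) c"
  obtains a b d a' where "a < a'" "a < b" "b < d" "{{a, b}, {a, d}, {a', b}} \<subseteq> snd G"
proof -
  note second_edge = line_graph_cycle_second_edge[OF card_edge no_claw cycle]
  have edges: "set c \<subseteq> snd G" and "c \<noteq> []"
    using cycle by (auto simp: is_cycle_def)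
  define a where "a = (LEAST x. \<exists>y. {x, y} \<in> set c)"
  have least: "a \<le> x" if "{x, y} \<in> set c" for x y
    unfolding a_def using that by (auto intro: Least_le)
  have "card (hd c) = 2"
    using card_edge edges hd_in_set[OF \<open>c \<noteq> []\<close>] by blast
  then obtain x y where "hd c = {x, y}"
    by (auto simp: card_2_iff)
  then have "\<exists>x y. {x, y} \<in> set c"
    using hd_in_set[OF \<open>c \<noteq> []\<close>] by auto
  then have "\<exists>y. {a, y} \<in> set c"
    unfolding a_def by (rule LeastI_ex)
  then obtain y where ay: "{a, y} \<in> set c" ..
  then obtain z where "z \<noteq> y" "{a, z} \<in> set c"
    using second_edge by blast
  with ay obtain b d where "b < d" and ab: "{a, b} \<in> set c" and ad: "{a, d} \<in> set c"
    by (metis neqE)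
  have ba: "{b, a} \<in> set c"
    using ab by (simp add: insert_commute)
  obtain a' where "a' \<noteq> a" "{b, a'} \<in> set c"
    using second_edge[OF ba] by blast
  then have a'b: "{a', b} \<in> set c"
    by (simp add: insert_commute)
  have "card {a, b} = 2"
    using card_edge edges ab by blast
  then have "a \<noteq> b"
    by auto
  then have "a < a'" "a < b"
    using least[OF a'b] least[OF ba] \<open>a' \<noteq> a\<close> by (simp_all add: order_less_le)
  then show thesis
    using that \<open>b < d\<close> ab ad a'b edges by blast
qed

lemma has_claw_increasingE:
  fixes G :: "'v::linorder ugraph"
  assumes "has_claw G"
  obtains x i j k where "i < j" "j < k" "{{x, i}, {x, j}, {x, k}} \<subseteq> snd G"
proof -
  obtain x y1 y2 y3 where "distinct [y1, y2, y3]"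
    and edges: "{{x, y1}, {x, y2}, {x, y3}} \<subseteq> snd G"
    using assms by (auto simp: has_claw_def)
  then consider "y1 < y2" "y2 < y3" | "y1 < y3" "y3 < y2" | "y2 < y1" "y1 < y3"
    | "y2 < y3" "y3 < y1" | "y3 < y1" "y1 < y2" | "y3 < y2" "y2 < y1"
    by (auto simp: neq_iff)
  then show thesis
    using that edges by cases auto
qed

section \<open>Pattern containment\<close>

lemma contains_pattern_iff_sorted_list:
  "contains_pattern \<pi> q \<longleftrightarrow>
    (\<exists>ps. length ps = length q \<and> sorted_wrt (<) ps \<and> set ps \<subseteq> {1..length \<pi>} \<and>
      (\<forall>k<length q. \<forall>l<length q. pval \<pi> (ps ! k) < pval \<pi> (ps ! l) \<longleftrightarrow> q ! k < q ! l))"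
    (is "_ \<longleftrightarrow> (\<exists>ps. ?occurrence ps)")
proof
  assume "contains_pattern \<pi> q"
  then obtain i where range: "i ` {1..length q} \<subseteq> {1..length \<pi>}"
    and mono: "strict_mono_on {1..length q} i"
    and order: "\<And>a b. a \<in> {1..length q} \<Longrightarrow> b \<in> {1..length q} \<Longrightarrow>
      pval \<pi> (i a) < pval \<pi> (i b) \<longleftrightarrow> pval q a < pval q b"
    unfolding contains_pattern_def by blast
  let ?ps = "map (\<lambda>k. i (Suc k)) [0..<length q]"
  have "sorted_wrt (<) ?ps"
    using mono by (simp add: sorted_wrt_iff_nth_less strict_mono_on_def)
  moreover have "set ?ps \<subseteq> {1..length \<pi>}"
    using range by fastforce
  moreover have "\<forall>k<length q. \<forall>l<length q. pval \<pi> (?ps ! k) < pval \<pi> (?ps ! l) \<longleftrightarrow> q ! k < q ! l"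
    using order by (simp add: pval_def)
  ultimately have "?occurrence ?ps"
    by simp
  then show "\<exists>ps. ?occurrence ps"
    by (rule exI[of _ ?ps])
next
  assume "\<exists>ps. ?occurrence ps"
  then obtain ps where length: "length ps = length q" and sorted: "sorted_wrt (<) ps"
    and range: "set ps \<subseteq> {1..length \<pi>}"
    and order: "\<And>k l. k < length q \<Longrightarrow> l < length q \<Longrightarrow>
      pval \<pi> (ps ! k) < pval \<pi> (ps ! l) \<longleftrightarrow> q ! k < q ! l"
    by blast
  have "strict_mono_on {1..length q} (pval ps)"
    using length sorted by (auto simp: strict_mono_on_def sorted_wrt_iff_nth_less pval_def)
  moreover have "pval ps ` {1..length q} \<subseteq> set ps"
    using length by (auto simp: pval_def)
  then have "pval ps ` {1..length q} \<subseteq> {1..length \<pi>}"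
    using range by (rule subset_trans)
  moreover have "\<forall>a\<in>{1..length q}. \<forall>b\<in>{1..length q}.
      pval \<pi> (pval ps a) < pval \<pi> (pval ps b) \<longleftrightarrow> pval q a < pval q b"
    using order by (simp add: pval_def Suc_le_lessD)
  ultimately show "contains_pattern \<pi> q"
    unfolding contains_pattern_def by blast
qed

lemma ex_length_Nil_iff: "(\<exists>xs. length xs = length [] \<and> P xs) \<longleftrightarrow> P []"
  by simp

lemma ex_length_Cons_iff:
  "(\<exists>xs. length xs = length (y # ys) \<and> P xs) \<longleftrightarrow> (\<exists>x xs. length xs = length ys \<and> P (x # xs))"
  by (auto simp: length_Suc_conv)

lemma contains_123_iff:
  "contains_pattern \<pi> [1, 2, 3] \<longleftrightarrow>
    (\<exists>a b c. 1 \<le> a \<and> a < b \<and> b < c \<and> c \<le> length \<pi> \<and>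
      pval \<pi> a < pval \<pi> b \<and> pval \<pi> b < pval \<pi> c)"
  unfolding contains_pattern_iff_sorted_list ex_length_Cons_iff ex_length_Nil_iff
  by (intro ex_cong1 iffI) (simp_all add: All_less_Suc)

lemma contains_1432_iff:
  "contains_pattern \<pi> [1, 4, 3, 2] \<longleftrightarrow>
    (\<exists>a b c d. 1 \<le> a \<and> a < b \<and> b < c \<and> c < d \<and> d \<le> length \<pi> \<and>
      pval \<pi> a < pval \<pi> d \<and> pval \<pi> d < pval \<pi> c \<and> pval \<pi> c < pval \<pi> b)"
  unfolding contains_pattern_iff_sorted_list ex_length_Cons_iff ex_length_Nil_iff
  by (intro ex_cong1 iffI) (simp_all add: All_less_Suc)

lemma contains_2143_iff:
  "contains_pattern \<pi> [2, 1, 4, 3] \<longleftrightarrow>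
    (\<exists>a b c d. 1 \<le> a \<and> a < b \<and> b < c \<and> c < d \<and> d \<le> length \<pi> \<and>
      pval \<pi> b < pval \<pi> a \<and> pval \<pi> a < pval \<pi> d \<and> pval \<pi> d < pval \<pi> c)"
  unfolding contains_pattern_iff_sorted_list ex_length_Cons_iff ex_length_Nil_iff
  by (intro ex_cong1 iffI) (simp_all add: All_less_Suc)

lemma contains_3214_iff:
  "contains_pattern \<pi> [3, 2, 1, 4] \<longleftrightarrow>
    (\<exists>a b c d. 1 \<le> a \<and> a < b \<and> b < c \<and> c < d \<and> d \<le> length \<pi> \<and>
      pval \<pi> c < pval \<pi> b \<and> pval \<pi> b < pval \<pi> a \<and> pval \<pi> a < pval \<pi> d)"
  unfolding contains_pattern_iff_sorted_list ex_length_Cons_iff ex_length_Nil_iff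
  by (intro ex_cong1 iffI) (simp_all add: All_less_Suc)

section \<open>The graph of ascending pairs\<close>

definition ascent_graph :: "nat list \<Rightarrow> nat ugraph" where
  "ascent_graph \<pi> = ({1..length \<pi>}, V12 \<pi>)"

abbreviation adjacent :: "nat list \<Rightarrow> nat \<Rightarrow> nat \<Rightarrow> bool" where
  "adjacent \<pi> i j \<equiv> {i, j} \<in> snd (ascent_graph \<pi>)"

lemma G12_eq_line_graph: "G12 \<pi> = line_graph (ascent_graph \<pi>)"
  by (simp add: G12_def line_graph_def ascent_graph_def)

lemma vertices_ascent_graph [simp]: "fst (ascent_graph \<pi>) = {1..length \<pi>}"
  by (simp add: ascent_graph_def)

lemma card_ascent_graph_edges: "\<forall>u\<in>snd (ascent_graph \<pi>). card u = 2"
  by (auto simp: ascent_graph_def V12_def card_2_iff)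

lemma adjacent_iff:
  "adjacent \<pi> i j \<longleftrightarrow> i \<in> {1..length \<pi>} \<and> j \<in> {1..length \<pi>} \<and>
    (i < j \<and> pval \<pi> i < pval \<pi> j \<or> j < i \<and> pval \<pi> j < pval \<pi> i)"
  by (auto simp: ascent_graph_def V12_def doubleton_eq_iff)

lemma not_is_forest_if_contains_123:
  assumes "contains_pattern \<pi> [1, 2, 3]"
  shows "\<not> is_forest (ascent_graph \<pi>)"
proof -
  obtain a b c where "1 \<le> a" "a < b" "b < c" "c \<le> length \<pi>"
    "pval \<pi> a < pval \<pi> b" "pval \<pi> b < pval \<pi> c"
    using assms unfolding contains_123_iff by blast
  then have "is_cycle (ascent_graph \<pi>) [a, b, c]"
    by (auto simp: is_cycle_def less_Suc_eq adjacent_iff)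
  then show ?thesis
    by (auto simp: is_forest_def)
qed

lemma not_is_forest_if_contains_2143:
  assumes "contains_pattern \<pi> [2, 1, 4, 3]"
  shows "\<not> is_forest (ascent_graph \<pi>)"
proof -
  obtain a b c d where "1 \<le> a" "a < b" "b < c" "c < d" "d \<le> length \<pi>"
    "pval \<pi> b < pval \<pi> a" "pval \<pi> a < pval \<pi> d" "pval \<pi> d < pval \<pi> c"
    using assms unfolding contains_2143_iff by blast
  then have "is_cycle (ascent_graph \<pi>) [a, c, b, d]"
    by (auto simp: is_cycle_def less_Suc_eq adjacent_iff)
  then show ?thesis
    by (auto simp: is_forest_def)
qed

lemma has_claw_if_contains_1432:
  assumes "contains_pattern \<pi> [1, 4, 3, 2]"
  shows "has_claw (ascent_graph \<pi>)"
proof -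
  obtain a b c d where "1 \<le> a" "a < b" "b < c" "c < d" "d \<le> length \<pi>"
    "pval \<pi> a < pval \<pi> d" "pval \<pi> d < pval \<pi> c" "pval \<pi> c < pval \<pi> b"
    using assms unfolding contains_1432_iff by blast
  then have "distinct [b, c, d]" "{{a, b}, {a, c}, {a, d}} \<subseteq> snd (ascent_graph \<pi>)"
    by (auto simp: adjacent_iff)
  then show ?thesis
    unfolding has_claw_def by blast
qed

lemma has_claw_if_contains_3214:
  assumes "contains_pattern \<pi> [3, 2, 1, 4]"
  shows "has_claw (ascent_graph \<pi>)"
proof -
  obtain a b c d where "1 \<le> a" "a < b" "b < c" "c < d" "d \<le> length \<pi>"
    "pval \<pi> c < pval \<pi> b" "pval \<pi> b < pval \<pi> a" "pval \<pi> a < pval \<pi> d"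
    using assms unfolding contains_3214_iff by blast
  then have "distinct [a, b, c]" "{{d, a}, {d, b}, {d, c}} \<subseteq> snd (ascent_graph \<pi>)"
    by (auto simp: adjacent_iff)
  then show ?thesis
    unfolding has_claw_def by blast
qed

lemma inj_on_pval:
  assumes "\<pi> \<in> perms"
  shows "inj_on (pval \<pi>) {1..length \<pi>}"
proof -
  have "distinct \<pi>"
    using assms by (auto simp: perms_def dest: permutations_of_setD)
  then show ?thesis
    by (auto simp: pval_def nth_eq_iff_index_eq intro!: inj_onI)
qed

lemma neighbours_decreasing:
  assumes "\<pi> \<in> perms" "\<not> contains_pattern \<pi> [1, 2, 3]"
    and "adjacent \<pi> x i" "adjacent \<pi> x j" "i < j"
  shows "pval \<pi> j < pval \<pi> i"
proof (rule ccontr)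
  assume "\<not> pval \<pi> j < pval \<pi> i"
  moreover have "pval \<pi> i \<noteq> pval \<pi> j"
    using inj_onD[OF inj_on_pval[OF assms(1)], of i j] assms(3-5) by (auto simp: adjacent_iff)
  ultimately have "pval \<pi> i < pval \<pi> j"
    by simp
  with assms(3-5) consider
    "x < i" "pval \<pi> x < pval \<pi> i" | "i < x" "x < j" "pval \<pi> i < pval \<pi> x" "pval \<pi> x < pval \<pi> j"
    | "j < x" "pval \<pi> j < pval \<pi> x"
    by (auto simp: adjacent_iff)
  then have "contains_pattern \<pi> [1, 2, 3]"
    using assms(3-5) \<open>pval \<pi> i < pval \<pi> j\<close> unfolding contains_123_iff
    by cases (auto simp: adjacent_iff)
  with assms(2) show False ..
qed

lemma contains_1432_or_3214_if_has_claw: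
  assumes "\<pi> \<in> perms" "\<not> contains_pattern \<pi> [1, 2, 3]" "has_claw (ascent_graph \<pi>)"
  shows "contains_pattern \<pi> [1, 4, 3, 2] \<or> contains_pattern \<pi> [3, 2, 1, 4]"
proof -
  obtain x i j k where "i < j" "j < k" and
    adj: "adjacent \<pi> x i" "adjacent \<pi> x j" "adjacent \<pi> x k"
    by (rule has_claw_increasingE[OF assms(3)]) auto
  then have decreasing: "pval \<pi> j < pval \<pi> i" "pval \<pi> k < pval \<pi> j"
    using neighbours_decreasing[OF assms(1,2)] by blast+
  then consider (left) "x < i" "pval \<pi> x < pval \<pi> k" | (right) "k < x" "pval \<pi> i < pval \<pi> x"
    using adj \<open>i < j\<close> \<open>j < k\<close> by (auto simp: adjacent_iff)
  then show ?thesis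
  proof cases
    case left
    then have "contains_pattern \<pi> [1, 4, 3, 2]"
      using adj decreasing \<open>i < j\<close> \<open>j < k\<close> unfolding contains_1432_iff
      by (intro exI[of _ x] exI[of _ i] exI[of _ j] exI[of _ k]) (auto simp: adjacent_iff)
    then show ?thesis ..
  next
    case right
    then have "contains_pattern \<pi> [3, 2, 1, 4]"
      using adj decreasing \<open>i < j\<close> \<open>j < k\<close> unfolding contains_3214_iff
      by (intro exI[of _ i] exI[of _ j] exI[of _ k] exI[of _ x]) (auto simp: adjacent_iff)
    then show ?thesis ..
  qed
qed

lemma contains_2143_if_line_graph_cycle:
  assumes perm: "\<pi> \<in> perms" and no_123: "\<not> contains_pattern \<pi> [1, 2, 3]"
    and no_claw: "\<not> has_claw (ascent_graph \<pi>)"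
    and cycle: "is_cycle (line_graph (ascent_graph \<pi>)) c"
  shows "contains_pattern \<pi> [2, 1, 4, 3]"
proof -
  obtain a b d a' where less: "a < a'" "a < b" "b < d" and
    adj: "{{a, b}, {a, d}, {a', b}} \<subseteq> snd (ascent_graph \<pi>)"
    using line_graph_cycle_leftmost_pathE[OF card_ascent_graph_edges no_claw cycle] .
  have "pval \<pi> d < pval \<pi> b"
    using neighbours_decreasing[OF perm no_123, of a b d] adj less by blast
  moreover have "pval \<pi> a' < pval \<pi> a"
    using neighbours_decreasing[OF perm no_123, of b a a'] adj less by (simp add: insert_commute)
  ultimately show ?thesis
    unfolding contains_2143_iff using adj less
    by (intro exI[of _ a] exI[of _ a'] exI[of _ b] exI[of _ d]) (auto simp: adjacent_iff)
qed

lemma is_forest_G12_iff: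
  assumes "\<pi> \<in> perms"
  shows "is_forest (G12 \<pi>) \<longleftrightarrow>
    (\<forall>q \<in> {[1,2,3], [1,4,3,2], [2,1,4,3], [3,2,1,4]}. \<not> contains_pattern \<pi> q)"
    (is "_ \<longleftrightarrow> ?avoids")
proof
  assume "is_forest (G12 \<pi>)"
  then have "is_forest (ascent_graph \<pi>)" "\<not> has_claw (ascent_graph \<pi>)"
    unfolding G12_eq_line_graph
    by (simp_all add: is_forest_if_is_forest_line_graph not_has_claw_if_is_forest_line_graph)
  then show ?avoids
    using not_is_forest_if_contains_123 not_is_forest_if_contains_2143
      has_claw_if_contains_1432 has_claw_if_contains_3214 by blast
next
  assume ?avoids
  moreover from this have "\<not> has_claw (ascent_graph \<pi>)"
    using contains_1432_or_3214_if_has_claw[OF assms] by blast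
  ultimately show "is_forest (G12 \<pi>)"
    using contains_2143_if_line_graph_cycle[OF assms]
    unfolding is_forest_def G12_eq_line_graph by blast
qed

theorem theorem5p6:
  shows "G12_forest = Av {[1,2,3], [1,4,3,2], [2,1,4,3], [3,2,1,4]}"
  unfolding G12_forest_def Av_def using is_forest_G12_iff by blast

end
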